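(* Let $g\ge 4$ be an integer and let $0<\delta<1$ be real. Suppose that $n$ and $d$ are integers satisfying $n\ge d\ge 2$ and $$\frac{1}{g-1}\binom{2g-4}{g-2}d^{\,g-1}\le \delta\,\frac{n}{H_n^2}.$$ Then there exists a $d$-degenerate graph $G$ with at most $n$ vertices and girth at least $g$ such that $$\chi_f(G)\ge (1-\delta)\frac{d}{W(d)+1}.$$
   Context: Graphs are finite and simple. $H_n=\sum_{j=1}^n\frac1j$ is the $n$-th harmonic number. For $d>0$, $W(d)$ is the Lambert $W$-function, i.e. the positive real number with $W(d)e^{W(d)}=d$. A graph $G$ on $m$ vertices is $d$-degenerate if there is an ordering $(v_1,\dots,v_m)$ of $V(G)$ such that for each $i$ the vertex $v_i$ has at most $d$ neighbors in the induced subgraph $G[\{v_1,\dots,v_i\}]$. Girth at least $g$ means that $G$ contains no cycle of length less than $g$. Let $\mathcal{I}(G)$ be the collection of all independent sets of $G$. The fractional chromatic number $\chi_f(G)$ is the minimum of $\sum_{I\in\mathcal{I}(G)}x_I$ over all $(x_I)_{I\in\mathcal{I}(G)}$ with $x_I\ge 0$ for all $I$ and $\sum_{I\in\mathcal{I}(G):\, v\in I}x_I\ge 1$ for every $v\in V(G)$. *)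

theory Defs
  imports "HOL-Analysis.Analysis" "Graph_Theory.Graph_Theory"
begin

text \<open>
  Finite simple graphs are rendered by the locale \<^locale>\<open>pair_graph\<close>: a finite vertex set with
  a symmetric irreflexive adjacency relation, each edge \<open>{u, v}\<close> being the two arcs
  \<open>(u, v)\<close> and \<open>(v, u)\<close>.
\<close>

definition degenerate :: "nat \<Rightarrow> 'a pair_pre_digraph \<Rightarrow> bool" where
  "degenerate d G \<longleftrightarrow>
     (\<exists>vs. distinct vs \<and> set vs = pverts G \<and>
        (\<forall>i<length vs.
           card {u. vs ! i \<rightarrow>\<^bsub>with_proj G \<restriction> set (take (Suc i) vs)\<^esub> u} \<le> d))"

text \<open>
  A library cycle is a nonempty closed walk without repeated vertices, so in a symmetric
  digraph the walk \<open>u, v, u\<close> along a single edge counts as a cycle of length 2. The cycles of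
  the undirected graph are those of length at least 3.
\<close>
definition girth_at_least :: "nat \<Rightarrow> 'a pair_pre_digraph \<Rightarrow> bool" where
  "girth_at_least g G \<longleftrightarrow>
     (\<forall>p. pre_digraph.cycle (with_proj G) p \<and> 3 \<le> length p \<longrightarrow> g \<le> length p)"

definition independent_sets :: "'a pair_pre_digraph \<Rightarrow> 'a set set" where
  "independent_sets G = {I. I \<subseteq> pverts G \<and> (\<forall>u\<in>I. \<forall>v\<in>I. (u, v) \<notin> parcs G)}"

definition fractional_colouring :: "'a pair_pre_digraph \<Rightarrow> ('a set \<Rightarrow> real) \<Rightarrow> bool" where
  "fractional_colouring G x \<longleftrightarrow>
     (\<forall>I\<in>independent_sets G. 0 \<le> x I) \<and>
     (\<forall>v\<in>pverts G. 1 \<le> (\<Sum>I | I \<in> independent_sets G \<and> v \<in> I. x I))"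

text \<open>The infimum is a minimum; see \<open>fractional_chromatic_number_attained\<close> below.\<close>
definition fractional_chromatic_number :: "'a pair_pre_digraph \<Rightarrow> real" where
  "fractional_chromatic_number G =
     Inf {\<Sum>I\<in>independent_sets G. x I | x. fractional_colouring G x}"

definition lambert_W :: "real \<Rightarrow> real" where
  "lambert_W d = (THE w. 0 < w \<and> w * exp w = d)"

lemma lambert_W:
  assumes "0 < d"
  shows "0 < lambert_W d" "lambert_W d * exp (lambert_W d) = d"
proof -
  have "\<exists>w\<ge>0. w \<le> d \<and> w * exp w = d"
    by (rule IVT') (use assms in \<open>auto intro!: continuous_intros\<close>)
  then obtain w where w: "0 \<le> w" "w * exp w = d" by blast
  with assms have w0: "0 < w" by (cases "w = 0") auto
  have less: "a * exp a < b * exp b" if "0 < a" "a < b" for a b :: real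
    using that by (intro mult_strict_mono) auto
  have "\<exists>!w. 0 < w \<and> w * exp w = d"
  proof (rule ex1I[of _ w])
    fix y assume y: "0 < y \<and> y * exp y = d"
    then show "y = w"
      using less[of y w] less[of w y] w w0 by (cases y w rule: linorder_cases) auto
  qed (use w w0 in auto)
  from theI'[OF this] show "0 < lambert_W d" "lambert_W d * exp (lambert_W d) = d"
    unfolding lambert_W_def by auto
qed

lemma fractional_chromatic_number_attained:
  assumes "pair_graph G"
  shows "\<exists>x. fractional_colouring G x \<and>
             fractional_chromatic_number G = (\<Sum>I\<in>independent_sets G. x I) \<and>
             (\<forall>y. fractional_colouring G y \<longrightarrow>
                (\<Sum>I\<in>independent_sets G. x I) \<le> (\<Sum>I\<in>independent_sets G. y I))"
proof -
  interpret pair_graph G by fact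
  define S where "S = independent_sets G"
  define S' where "S' v = {I \<in> S. v \<in> I}" for v
  have S'_eq: "{I. I \<in> independent_sets G \<and> v \<in> I} = S' v" for v
    by (simp add: S'_def S_def)
  have "S \<subseteq> Pow (pverts G)" by (auto simp: S_def independent_sets_def)
  then have finS: "finite S" using pair_finite_verts finite_subset by blast
  then have finS': "finite (S' v)" for v by (simp add: S'_def)
  have sing: "{v} \<in> S' v" if "v \<in> pverts G" for v
    using that pair_no_loops[of "(v, v)"] by (auto simp: S'_def S_def independent_sets_def)
  have col: "fractional_colouring G x \<longleftrightarrow>
      (\<forall>I\<in>S. 0 \<le> x I) \<and> (\<forall>v\<in>pverts G. 1 \<le> (\<Sum>I\<in>S' v. x I))" for x
    by (simp add: fractional_colouring_def S'_eq S_def)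
  define B :: "('a set \<Rightarrow> real) set" where "B = PiE UNIV (\<lambda>_. {0..1})"
  define K where "K = B \<inter> (\<Inter>v\<in>pverts G. {x. 1 \<le> (\<Sum>I\<in>S' v. x I)})"
  have cont: "continuous_on A (\<lambda>x. \<Sum>I\<in>T. x I)"
    for A :: "('a set \<Rightarrow> real) set" and T
    by (intro continuous_on_sum continuous_on_subset[OF continuous_on_product_coordinates]) simp
  have "compactin (product_topology (\<lambda>_. euclidean) UNIV) B"
    unfolding B_def by (subst compactin_PiE) auto
  then have "compact B" by (simp add: euclidean_product_topology)
  moreover have "closed {x :: 'a set \<Rightarrow> real. 1 \<le> (\<Sum>I\<in>S' v. x I)}" for v
    by (intro closed_Collect_le continuous_on_const cont)
  ultimately have "compact K"
    unfolding K_def by (intro compact_Int_closed closed_INT) auto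
  have sum_one: "1 \<le> (\<Sum>I\<in>T. x I)"
    if "finite T" "J \<in> T" "x J = (1::real)" "\<And>I. I \<in> T \<Longrightarrow> 0 \<le> x I" for T x and J :: "'a set"
    using member_le_sum[of J T x] that by auto
  have "1 \<le> (\<Sum>I\<in>S' v. 1 :: real)" if "v \<in> pverts G" for v
    using finS' sing[OF that] by (rule sum_one) auto
  then have "(\<lambda>_. 1) \<in> K" by (auto simp: K_def B_def)
  then have "K \<noteq> {}" by auto
  from continuous_attains_inf[OF \<open>compact K\<close> this cont[of K S]]
  obtain x where x: "x \<in> K" and min: "\<And>y. y \<in> K \<Longrightarrow> (\<Sum>I\<in>S. x I) \<le> (\<Sum>I\<in>S. y I)"
    by blast
  have xcol: "fractional_colouring G x"
    using x by (auto simp: col K_def B_def)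
  have le: "(\<Sum>I\<in>S. x I) \<le> (\<Sum>I\<in>S. y I)" if y: "fractional_colouring G y" for y
  proof -
    define z where "z I = (if I \<in> S then min 1 (y I) else 0)" for I
    have z0: "0 \<le> z I" "z I \<le> 1" for I using y by (auto simp: z_def col)
    have "1 \<le> (\<Sum>I\<in>S' v. z I)" if v: "v \<in> pverts G" for v
    proof (cases "\<exists>J\<in>S' v. 1 \<le> y J")
      case True
      then obtain J where "J \<in> S' v" "1 \<le> y J" by blast
      then show ?thesis
        by (intro sum_one[of _ J] finS' z0(1)) (auto simp: z_def S'_def)
    next
      case False
      then have "(\<Sum>I\<in>S' v. z I) = (\<Sum>I\<in>S' v. y I)"
        by (intro sum.cong) (auto simp: z_def S'_def)
      then show ?thesis using y v by (simp add: col)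
    qed
    then have "z \<in> K" using z0 by (auto simp: K_def B_def)
    then have "(\<Sum>I\<in>S. x I) \<le> (\<Sum>I\<in>S. z I)" by (rule min)
    also have "\<dots> \<le> (\<Sum>I\<in>S. y I)" by (intro sum_mono) (auto simp: z_def)
    finally show ?thesis .
  qed
  have "fractional_chromatic_number G = (\<Sum>I\<in>S. x I)"
    unfolding fractional_chromatic_number_def S_def[symmetric]
    by (rule cInf_eq_minimum) (use xcol le in auto)
  with xcol le show ?thesis unfolding S_def by blast
qed

end

theory Submission
  imports Defs
begin

text \<open>
  Let every vertex \<open>v < n\<close> choose \<open>d\<close> independent uniform elements of \<open>{0..v}\<close> and join it to those
  that differ from \<open>v\<close>; the result is \<open>d\<close>-degenerate. Cutting a path at its largest vertex gives a
  Catalan recurrence, from which \<open>v\<close> is the largest vertex of a cycle shorter than \<open>g\<close> with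
  probability at most \<open>4/3 * T / (v + 1)\<close>, where \<open>T\<close> is the left-hand side of the hypothesis.
  These vertices are deleted.

  For a set \<open>I\<close> put \<open>\<Phi>(I) = d * (\<Sum>i\<in>I. card (I \<inter> {..<i}) / (i + 1))\<close>. Then \<open>I\<close> is
  independent with probability at most \<open>exp (- \<Phi>(I))\<close>, so by averaging all independent sets satisfy
  \<open>\<Phi>(I) \<le> ln 4 + n * q + card I * ln (1 / q)\<close> simultaneously, with probability at least \<open>3/4\<close>.
  Bounding \<open>\<Phi>\<close> from below by its tangent at density \<open>x\<close> makes this a linear inequality
  \<open>(\<Sum>v\<in>I. w v) \<le> B\<close>, and \<open>w\<close> is a dual solution of the linear program for \<open>\<chi>\<^sub>f\<close>. The choices
  \<open>x = (W(d) + 1) / d\<close> and \<open>q = W(d) / d = exp (- W(d))\<close> give total weight about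
  \<open>(W(d) + 2) * n\<close> and \<open>B\<close> about \<open>((W(d) + 1) * (W(d) + 2) - 1) * n / d\<close>; the deleted weight
  is of order \<open>(W(d) + 1) * T * H\<^sub>n\<^sup>2\<close>, which is where the hypothesis enters.
\<close>

section \<open>Catalan numbers\<close>

text \<open>At \<open>m = g - 2\<close> this is the constant
  \<open>1 / (g - 1) * ((2 * g - 4) choose (g - 2))\<close> of the hypothesis.\<close>

definition catalan :: "nat \<Rightarrow> real" where
  "catalan m = real ((2 * m) choose m) / real (m + 1)"

lemma catalan_0 [simp]: "catalan 0 = 1"
  by (simp add: catalan_def)

lemma catalan_nonneg: "0 \<le> catalan m"
  by (simp add: catalan_def)

lemma catalan_Suc: "(real m + 2) * catalan (Suc m) = (4 * real m + 2) * catalan m"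
proof -
  have 1: "Suc (2 * m) * (2 * m choose m) = (Suc (2 * m) choose m) * Suc m"
    using binomial_absorb_comp[of "Suc (2 * m)" m] by (simp add: mult.commute)
  have 2: "(2 * Suc m choose Suc m) * Suc m = 2 * Suc m * (Suc (2 * m) choose m)"
    using Suc_times_binomial_eq[of "Suc (2 * m)" m] by simp
  have r1: "(2 * real m + 1) * real (2 * m choose m) = real (Suc (2 * m) choose m) * (real m + 1)"
    using arg_cong[OF 1, of real] by (simp add: algebra_simps)
  have r2: "real (2 * Suc m choose Suc m) = 2 * real (Suc (2 * m) choose m)"
  proof -
    have "Suc m * (2 * Suc m choose Suc m) = Suc m * (2 * (Suc (2 * m) choose m))"
      using 2 by (simp only: mult_ac)
    then show ?thesis by (simp only: Suc_mult_cancel1 of_nat_mult of_nat_numeral)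
  qed
  have "catalan (Suc m) = 2 * real (Suc (2 * m) choose m) / (real m + 2)"
    unfolding catalan_def r2 by simp
  moreover have "(4 * real m + 2) * catalan m = 2 * real (Suc (2 * m) choose m)"
    unfolding catalan_def using r1 by (simp add: field_simps)
  ultimately show ?thesis by simp
qed

lemma catalan_2: "catalan 2 = 2"
  by (simp add: catalan_def choose_two numeral_eq_Suc)

lemma catalan_Suc_ge: "1 \<le> m \<Longrightarrow> 2 * catalan m \<le> catalan (Suc m)"
proof -
  assume m: "1 \<le> m"
  have "(real m + 2) * (2 * catalan m) \<le> (4 * real m + 2) * catalan m"
    using m mult_right_mono[of "2 * real m + 4" "4 * real m + 2", OF _ catalan_nonneg[of m]]
    by (simp add: algebra_simps)
  then show ?thesis
    by (simp add: catalan_Suc[symmetric])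
qed

text \<open>
  Put \<open>S m = \<Sum>a\<le>m. catalan a * catalan (m - a)\<close>. By the symmetry \<open>a \<mapsto> m - a\<close> the weight
  \<open>a\<close> may be replaced by \<open>m / 2\<close>, so the sum of \<open>(a + 1) * catalan a * catalan (m - a)\<close> is
  \<open>(m + 2) / 2 * S m\<close>; expanding \<open>(a + 1) * catalan a\<close> by the one-term recurrence also gives
  \<open>catalan m + 2 * m * S (m - 1)\<close>.
\<close>
lemma catalan_convolution: "(\<Sum>a\<le>m. catalan a * catalan (m - a)) = catalan (Suc m)"
proof (induction m)
  case 0
  then show ?case by (simp add: catalan_def)
next
  case (Suc m)
  have sym: "2 * (\<Sum>a\<le>k. real a * catalan a * catalan (k - a))
      = real k * (\<Sum>a\<le>k. catalan a * catalan (k - a))" for k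
  proof -
    let ?t = "\<lambda>a. real a * catalan a * catalan (k - a)"
    have "2 * sum ?t {..k} = sum ?t {..k} + (\<Sum>a\<le>k. ?t (k - a))"
      using sum.reindex_bij_witness[of "{..k}" "\<lambda>a. k - a" "\<lambda>a. k - a" "{..k}" "\<lambda>a. ?t (k - a)" ?t]
      by simp
    also have "\<dots> = (\<Sum>a\<le>k. real k * (catalan a * catalan (k - a)))"
      unfolding sum.distrib[symmetric]
      by (rule sum.cong) (auto simp: of_nat_diff algebra_simps)
    finally show ?thesis by (simp add: sum_distrib_left)
  qed
  let ?S = "\<lambda>k. \<Sum>a\<le>k. catalan a * catalan (k - a)"
  have "(\<Sum>a\<le>Suc m. (real a + 1) * catalan a * catalan (Suc m - a))
      = catalan (Suc m) + (\<Sum>a\<le>m. (real a + 2) * catalan (Suc a) * catalan (m - a))"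
    by (simp add: sum.atMost_Suc_shift add_ac del: sum.atMost_Suc)
  also have "(\<Sum>a\<le>m. (real a + 2) * catalan (Suc a) * catalan (m - a))
      = 4 * (\<Sum>a\<le>m. real a * catalan a * catalan (m - a)) + 2 * ?S m"
    unfolding catalan_Suc sum_distrib_left sum.distrib[symmetric]
    by (rule sum.cong) (simp_all add: algebra_simps)
  also have "\<dots> = (2 * real m + 2) * catalan (Suc m)"
    using sym[of m] by (simp add: Suc algebra_simps)
  finally have "(\<Sum>a\<le>Suc m. (real a + 1) * catalan a * catalan (Suc m - a))
      = (2 * real m + 3) * catalan (Suc m)" by (simp add: algebra_simps)
  moreover have "(\<Sum>a\<le>Suc m. (real a + 1) * catalan a * catalan (Suc m - a))
      = (\<Sum>a\<le>Suc m. real a * catalan a * catalan (Suc m - a)) + ?S (Suc m)"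
    by (simp add: sum.distrib[symmetric] algebra_simps del: sum.atMost_Suc)
  ultimately have "(real m + 3) * ?S (Suc m) = (4 * real m + 6) * catalan (Suc m)"
    using sym[of "Suc m"] by (simp add: algebra_simps)
  also have "\<dots> = (real m + 3) * catalan (Suc (Suc m))"
    using catalan_Suc[of "Suc m"] by (simp add: algebra_simps)
  finally show ?case by simp
qed

text \<open>Consecutive terms grow at least by the factor 4, a 2 from \<open>catalan_Suc_ge\<close>
  and a 2 from \<open>d\<close>, so the last term dominates with the geometric constant 1 + 1/4 +
  1/16 + ... = 4/3.\<close>

lemma catalan_power_sum:
  fixes d :: real
  assumes "2 \<le> d"
  shows "(\<Sum>m=2..2+k. catalan m * d ^ Suc m) \<le> 4 / 3 * (catalan (2 + k) * d ^ (3 + k))"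
proof (induction k)
  case 0
  have "0 \<le> catalan 2 * d ^ 3" using catalan_nonneg assms by simp
  moreover have "(\<Sum>m=2..2+0. catalan m * d ^ Suc m) = catalan 2 * d ^ 3"
    by (simp add: numeral_3_eq_3)
  ultimately show ?case by simp
next
  case (Suc k)
  let ?t = "\<lambda>m. catalan m * d ^ Suc m"
  have "4 * catalan (2 + k) \<le> catalan (3 + k) * d"
    using mult_mono[OF catalan_Suc_ge[of "2 + k"] assms] catalan_nonneg[of "3 + k"]
    by (simp add: eval_nat_numeral)
  then have "4 * catalan (2 + k) * d ^ (3 + k) \<le> catalan (3 + k) * d * d ^ (3 + k)"
    using assms by (intro mult_right_mono) auto
  then have "4 * ?t (2 + k) \<le> ?t (3 + k)"
    by (simp add: eval_nat_numeral algebra_simps)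
  moreover have "sum ?t {2..2 + Suc k} = sum ?t {2..2 + k} + ?t (3 + k)"
    by (simp add: eval_nat_numeral)
  ultimately show ?case using Suc by (simp add: eval_nat_numeral algebra_simps)
qed

section \<open>Weighted paths\<close>

text \<open>Edges are oriented from the larger to the smaller endpoint, to match
  \<open>down_arcs\<close>.\<close>

fun path_arcs :: "nat list \<Rightarrow> (nat \<times> nat) set" where
  "path_arcs (x # y # l) = insert (max x y, min x y) (path_arcs (y # l))"
| "path_arcs _ = {}"

text \<open>Each edge contributes the probability that one given choice of its larger endpoint hits
  the smaller one; the factor \<open>d\<close> per edge is kept outside.\<close>

fun path_weight :: "nat list \<Rightarrow> real" where
  "path_weight (x # y # l) = path_weight (y # l) / (real (max x y) + 1)"
| "path_weight _ = 1"

definition vpaths :: "nat \<Rightarrow> nat \<Rightarrow> nat list set" where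
  "vpaths M m = {us. length us = m \<and> distinct us \<and> set us \<subseteq> {..<M}}"

lemma finite_vpaths [simp, intro]: "finite (vpaths M m)"
  by (rule finite_subset[OF _ finite_lists_length_eq[of "{..<M}" m]]) (auto simp: vpaths_def)

lemma path_weight_nonneg: "0 \<le> path_weight us"
  by (induction us rule: path_weight.induct) auto

lemma finite_path_arcs [simp, intro]: "finite (path_arcs us)"
  by (induction us rule: path_arcs.induct) auto

lemma path_arcs_in_set: "a \<in> path_arcs us \<Longrightarrow> fst a \<in> set us \<and> snd a \<in> set us"
  by (induction us rule: path_arcs.induct) (auto simp: max_def min_def split: if_splits)

lemma path_arcs_snoc: "us \<noteq> [] \<Longrightarrow>
    path_arcs (us @ [v]) = insert (max (last us) v, min (last us) v) (path_arcs us)"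
  by (induction us rule: path_arcs.induct) auto

lemma prod_path_arcs:
  "distinct us \<Longrightarrow> (\<Prod>a\<in>path_arcs us. c / (real (fst a) + 1)) = c ^ (length us - 1) * path_weight us"
proof (induction us rule: path_arcs.induct)
  case (1 x y l)
  have "(max x y, min x y) \<notin> path_arcs (y # l)"
    using path_arcs_in_set[of "(max x y, min x y)" "y # l"] 1(2) by (auto simp: max_def min_def split: if_splits)
  with 1 show ?case by simp
qed auto

text \<open>With at least two vertices in \<open>us\<close> the two edges at \<open>v\<close> are
  distinct, and both have \<open>v\<close> as larger endpoint: hence the square.\<close>

lemma prod_closed_path_arcs:
  assumes us: "us \<in> vpaths v m" and m: "2 \<le> m"
  shows "(\<Prod>a\<in>path_arcs (v # us @ [v]). c / (real (fst a) + 1))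
    = c ^ Suc m * path_weight us / (real v + 1)\<^sup>2"
proof -
  have len: "length us = m" "distinct us" "\<And>x. x \<in> set us \<Longrightarrow> x < v"
    using us by (auto simp: vpaths_def)
  have ne: "us \<noteq> []" using len m by auto
  then obtain h t where ht: "us = h # t" by (cases us) auto
  have tne: "t \<noteq> []" using ht len m by auto
  have hd: "h < v" and la: "last us < v" using ne ht len by auto
  have neq: "h \<noteq> last us" using len(2) ht tne by auto
  have eq: "path_arcs (v # us @ [v]) = insert (v, h) (insert (v, last us) (path_arcs us))"
    using path_arcs_snoc[OF ne, of v] hd la ht by (auto simp: max_def min_def)
  have notin: "(v, x) \<notin> path_arcs us" for x
    using path_arcs_in_set[of "(v, x)" us] len(3) by auto
  show ?thesis unfolding eq using neq notin prod_path_arcs[OF len(2), of c] len(1) ht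
    by (auto simp: power2_eq_square)
qed

text \<open>All edges at \<open>t\<close> have \<open>t\<close> as larger endpoint. An empty side
  has no edge to \<open>t\<close>, which is why its factor is 1.\<close>

lemma path_weight_split:
  assumes "\<And>x. x \<in> set l \<Longrightarrow> x < t" "\<And>x. x \<in> set r \<Longrightarrow> x < t"
  shows "path_weight (l @ t # r) =
    (path_weight l / (if l = [] then 1 else real t + 1)) *
    (path_weight r / (if r = [] then 1 else real t + 1))"
  using assms(1)
proof (induction l rule: path_weight.induct)
  case (1 x y l)
  then show ?case by simp
next
  case "2_1"
  then show ?case using assms(2) by (cases r) auto
next
  case ("2_2" x)
  then show ?case using assms(2) by (cases r) auto
qed

text \<open>
  A path is cut at its largest vertex \<open>t\<close>, whose at most two edges have weight \<open>1 / (t + 1)\<close>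
  each. The two remaining pieces satisfy the same bound by induction, which leads to the
  Catalan recurrence.
\<close>
lemma sum_path_weight:
  "(\<Sum>us\<in>vpaths M m. path_weight us) \<le> catalan m * (if m = 0 then 1 else real M)"
proof (induction m arbitrary: M rule: less_induct)
  case (less m)
  show ?case
  proof (cases m)
    case 0
    then have "vpaths M m = {[]}" by (auto simp: vpaths_def)
    then show ?thesis using 0 by simp
  next
    case (Suc k)
    define c where "c t l = path_weight l / (if l = [] then 1 else real t + 1)" for t l
    have c0: "0 \<le> c t l" for t l by (simp add: c_def path_weight_nonneg)
    \<comment> \<open>The factor \<open>t\<close> from the induction hypothesis is cancelled by the
      denominator \<open>t + 1\<close> of the connecting edge, so the estimate does not depend on
      \<open>t\<close>.\<close>
    have piece: "(\<Sum>l\<in>vpaths t a. c t l) \<le> catalan a" if "a \<le> k" for t a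
    proof (cases "a = 0")
      case True
      then have "vpaths t a = {[]}" by (auto simp: vpaths_def)
      then show ?thesis using True by (simp add: c_def)
    next
      case False
      have "(\<Sum>l\<in>vpaths t a. c t l) = (\<Sum>l\<in>vpaths t a. path_weight l) / (real t + 1)"
        unfolding sum_divide_distrib
        by (rule sum.cong) (use False in \<open>auto simp: c_def vpaths_def\<close>)
      also have "\<dots> \<le> catalan a * real t / (real t + 1)"
        using less.IH[of a t] that Suc False by (intro divide_right_mono) auto
      also have "\<dots> \<le> catalan a"
        using catalan_nonneg[of a] by (simp add: field_simps)
      finally show ?thesis .
    qed
    \<comment> \<open>\<open>X\<close> ignores that the two pieces are disjoint; the additional
      tuples only enlarge a nonnegative sum.\<close>
    define X where "X = (SIGMA t:{..<M}. SIGMA a:{..k}. vpaths t a \<times> vpaths t (k - a))"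
    define j :: "nat \<times> nat \<times> nat list \<times> nat list \<Rightarrow> nat list"
      where "j = (\<lambda>(t, a, l, r). l @ t # r)"
    have finX: "finite X" unfolding X_def by (intro finite_SigmaI) auto
    have sub: "vpaths M m \<subseteq> j ` X"
    proof
      fix us assume us: "us \<in> vpaths M m"
      then have ne: "us \<noteq> []" and d: "distinct us" and len: "length us = Suc k"
        and M: "set us \<subseteq> {..<M}" using Suc by (auto simp: vpaths_def)
      define t where "t = Max (set us)"
      have t: "t \<in> set us" "\<And>x. x \<in> set us \<Longrightarrow> x \<le> t" using ne by (auto simp: t_def)
      then obtain l r where lr: "us = l @ t # r" by (metis in_set_conv_decomp)
      have lt: "x < t" if "x \<in> set l \<union> set r" for x
        using t(2)[of x] that d lr by (auto simp: less_le)
      have "(t, length l, l, r) \<in> X"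
        using lr d len M lt by (auto simp: X_def vpaths_def)
      then show "us \<in> j ` X" using lr by (force simp: j_def)
    qed
    have "(\<Sum>us\<in>vpaths M m. path_weight us) \<le> (\<Sum>us\<in>j ` X. path_weight us)"
      by (rule sum_mono2) (use finX sub path_weight_nonneg in auto)
    also have "\<dots> \<le> (\<Sum>x\<in>X. path_weight (j x))"
      using sum_image_le[of X path_weight j] finX path_weight_nonneg by (simp add: o_def)
    also have "\<dots> = (\<Sum>x\<in>X. case x of (t, a, l, r) \<Rightarrow> c t l * c t r)"
    proof (rule sum.cong)
      fix x assume x: "x \<in> X"
      obtain t a l r where tup: "x = (t, a, l, r)" by (cases x)
      have "path_weight (l @ t # r) = c t l * c t r"
        unfolding c_def by (rule path_weight_split) (use x tup in \<open>auto simp: X_def vpaths_def\<close>)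
      then show "path_weight (j x) = (case x of (t, a, l, r) \<Rightarrow> c t l * c t r)"
        by (simp add: j_def tup)
    qed simp
    also have "\<dots> = (\<Sum>t<M. \<Sum>a\<le>k. \<Sum>l\<in>vpaths t a. \<Sum>r\<in>vpaths t (k - a). c t l * c t r)"
      unfolding X_def
      by (subst sum.Sigma[symmetric], simp, force, rule sum.cong[OF refl],
          subst sum.Sigma[symmetric], simp, force, rule sum.cong[OF refl],
          rule sum.cartesian_product[symmetric])
    also have "\<dots> = (\<Sum>t<M. \<Sum>a\<le>k. (\<Sum>l\<in>vpaths t a. c t l) * (\<Sum>r\<in>vpaths t (k - a). c t r))"
      by (simp add: sum_product)
    also have "\<dots> \<le> (\<Sum>t<M. \<Sum>a\<le>k. catalan a * catalan (k - a))"
      by (intro sum_mono mult_mono piece sum_nonneg c0 catalan_nonneg) auto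
    also have "\<dots> = catalan m * real M"
      by (simp add: catalan_convolution Suc)
    finally show ?thesis using Suc by simp
  qed
qed

section \<open>Random choices\<close>

text \<open>The sample space; probabilities are proportions of its cardinality. The value
  \<open>v\<close> in a slot of \<open>v\<close> stands for no edge, which keeps the range nonempty
  at \<open>v = 0\<close>.\<close>

definition choices :: "nat \<Rightarrow> nat \<Rightarrow> (nat \<times> nat \<Rightarrow> nat) set" where
  "choices n d = PiE ({..<n} \<times> {..<d}) (\<lambda>s. {..fst s})"

definition down_arcs :: "nat \<Rightarrow> (nat \<times> nat \<Rightarrow> nat) \<Rightarrow> (nat \<times> nat) set" where
  "down_arcs d f = {(v, u). u < v \<and> (\<exists>j<d. f (v, j) = u)}"

lemma finite_choices [simp, intro]: "finite (choices n d)"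
  unfolding choices_def by (intro finite_PiE) auto

lemma card_choices: "real (card (choices n d)) = (\<Prod>s\<in>{..<n} \<times> {..<d}. real (fst s) + 1)"
  unfolding choices_def by (subst card_PiE) (auto simp: add.commute)

lemma card_choices_pos: "0 < real (card (choices n d))"
  unfolding card_choices by (intro prod_pos) auto

text \<open>\<open>J\<close> names the slot responsible for each arc. Distinct slots are
  independent; two different arcs assigned to the same slot contradict each other, and no choice
  remains.\<close>

lemma card_choices_prescribed:
  fixes J :: "nat \<times> nat \<Rightarrow> nat"
  assumes A: "finite A" "\<And>a. a \<in> A \<Longrightarrow> fst a < n" and J: "\<And>a. a \<in> A \<Longrightarrow> J a < d"
  shows "real (card {f \<in> choices n d. \<forall>a\<in>A. f (fst a, J a) = snd a})
    \<le> real (card (choices n d)) * (\<Prod>a\<in>A. 1 / (real (fst a) + 1))"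
    (is "real (card ?N) \<le> _")
proof (cases "inj_on (\<lambda>a. (fst a, J a)) A")
  case False
  then obtain a b where ab: "a \<in> A" "b \<in> A" "a \<noteq> b" "fst a = fst b" "J a = J b"
    by (auto simp: inj_on_def)
  have "?N = {}"
  proof -
    have False if "f \<in> ?N" for f
    proof -
      have "f (fst a, J a) = snd a" "f (fst b, J b) = snd b" using that ab(1,2) by auto
      then show False using ab by (simp add: prod_eq_iff)
    qed
    then show ?thesis by blast
  qed
  then have "card ?N = 0" by (simp only: card.empty)
  moreover have "0 \<le> real (card (choices n d)) * (\<Prod>a\<in>A. 1 / (real (fst a) + 1))"
    by (intro mult_nonneg_nonneg prod_nonneg) auto
  ultimately show ?thesis by linarith
next
  case True
  let ?S = "{..<n} \<times> {..<d}" and ?k = "\<lambda>a. (fst a, J a)"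
  define B where "B s = {y. y \<le> fst s \<and> (\<forall>a\<in>A. ?k a = s \<longrightarrow> y = snd a)}" for s
  have finB: "finite (B s)" for s by (rule finite_subset[of _ "{..fst s}"]) (auto simp: B_def)
  have sub: "?k ` A \<subseteq> ?S" using A J by auto
  have "?N \<subseteq> PiE ?S B"
    by (auto simp: choices_def B_def PiE_iff extensional_def)
  then have "card ?N \<le> card (PiE ?S B)"
    by (rule card_mono[rotated]) (auto intro!: finite_PiE finB)
  then have "real (card ?N) \<le> real (card (PiE ?S B))" by simp
  also have "\<dots> = (\<Prod>s\<in>?S. real (card (B s)))"
    by (subst card_PiE) auto
  also have "\<dots> \<le> (\<Prod>s\<in>?S. (real (fst s) + 1) * (if s \<in> ?k ` A then 1 / (real (fst s) + 1) else 1))"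
  proof (rule prod_mono, intro conjI)
    fix s assume "s \<in> ?S"
    show "real (card (B s)) \<le> (real (fst s) + 1) * (if s \<in> ?k ` A then 1 / (real (fst s) + 1) else 1)"
    proof (cases "s \<in> ?k ` A")
      case True
      then obtain a where "a \<in> A" "s = ?k a" by auto
      then have "B s \<subseteq> {snd a}" by (auto simp: B_def)
      then have "card (B s) \<le> card {snd a}" by (rule card_mono[rotated]) simp
      then show ?thesis using True by simp
    next
      case False
      have "card (B s) \<le> card {..fst s}" by (rule card_mono) (auto simp: B_def)
      then show ?thesis using False by simp
    qed
  qed simp
  also have "\<dots> = real (card (choices n d)) * (\<Prod>s\<in>?k ` A. 1 / (real (fst s) + 1))"
  proof -
    have "(\<Prod>s\<in>?k ` A. 1 / (real (fst s) + 1))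
        = (\<Prod>s\<in>?S. if s \<in> ?k ` A then 1 / (real (fst s) + 1) else 1)"
      by (rule prod.mono_neutral_cong_left) (use sub in auto)
    then show ?thesis by (simp add: prod.distrib card_choices)
  qed
  also have "(\<Prod>s\<in>?k ` A. 1 / (real (fst s) + 1)) = (\<Prod>a\<in>A. 1 / (real (fst a) + 1))"
    by (subst prod.reindex[OF True]) simp
  finally show ?thesis .
qed

text \<open>Union bound over the \<open>d ^ card A\<close> assignments of slots to arcs, which gives
  each arc its factor \<open>d\<close>.\<close>

lemma card_choices_down_arcs:
  assumes A: "finite A" "\<And>a. a \<in> A \<Longrightarrow> fst a < n"
  shows "real (card {f \<in> choices n d. A \<subseteq> down_arcs d f})
    \<le> real (card (choices n d)) * (\<Prod>a\<in>A. real d / (real (fst a) + 1))"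
proof -
  let ?J = "PiE A (\<lambda>_. {..<d})"
  define N where "N J = {f \<in> choices n d. \<forall>a\<in>A. f (fst a, J a) = snd a}" for J
  have finJ: "finite ?J" using A by (intro finite_PiE) auto
  have sub: "{f \<in> choices n d. A \<subseteq> down_arcs d f} \<subseteq> (\<Union>J\<in>?J. N J)"
  proof
    fix f assume f: "f \<in> {f \<in> choices n d. A \<subseteq> down_arcs d f}"
    then have "\<forall>a\<in>A. \<exists>j<d. f (fst a, j) = snd a" by (fastforce simp: down_arcs_def)
    then obtain J where J: "\<And>a. a \<in> A \<Longrightarrow> J a < d \<and> f (fst a, J a) = snd a" by metis
    then have "restrict J A \<in> ?J" "f \<in> N (restrict J A)" using f by (auto simp: N_def)
    then show "f \<in> (\<Union>J\<in>?J. N J)" by blast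
  qed
  have "card {f \<in> choices n d. A \<subseteq> down_arcs d f} \<le> card (\<Union>J\<in>?J. N J)"
    by (rule card_mono[OF _ sub]) (auto simp: N_def finJ)
  also have "\<dots> \<le> (\<Sum>J\<in>?J. card (N J))" by (rule card_UN_le[OF finJ])
  finally have "real (card {f \<in> choices n d. A \<subseteq> down_arcs d f}) \<le> (\<Sum>J\<in>?J. real (card (N J)))"
    unfolding of_nat_sum[symmetric] of_nat_le_iff .
  also have "\<dots> \<le> (\<Sum>J\<in>?J. real (card (choices n d)) * (\<Prod>a\<in>A. 1 / (real (fst a) + 1)))"
    unfolding N_def by (intro sum_mono card_choices_prescribed A) auto
  also have "\<dots> = real (card (choices n d)) * (\<Prod>a\<in>A. real d / (real (fst a) + 1))"
    using A by (simp add: card_PiE prod_dividef)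
  finally show ?thesis .
qed

text \<open>Each of the \<open>d\<close> slots of a vertex of \<open>I\<close> must avoid the
  smaller elements of \<open>I\<close>. Slots are independent, and
  \<open>1 - p \<le> exp (- p)\<close> turns the product into one exponential.\<close>

lemma card_choices_independent:
  assumes I: "I \<subseteq> {..<n}"
  shows "real (card {f \<in> choices n d. \<forall>a\<in>I. \<forall>b\<in>I. (a, b) \<notin> down_arcs d f})
    \<le> real (card (choices n d))
        * exp (- (real d * (\<Sum>i\<in>I. real (card (I \<inter> {..<i})) / (real i + 1))))"
    (is "real (card ?N) \<le> _")
proof -
  let ?S = "{..<n} \<times> {..<d}"
  define B where "B s = {..fst s} - (if fst s \<in> I then I \<inter> {..<fst s} else {})" for s :: "nat \<times> nat"
  define h where "h i = (if i \<in> I then real (card (I \<inter> {..<i})) / (real i + 1) else 0)" for i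
  have "?N \<subseteq> PiE ?S B"
  proof
    fix f assume f: "f \<in> ?N"
    have "f s \<in> B s" if s: "s \<in> ?S" for s
    proof -
      have "f s \<le> fst s" using f s by (force simp: choices_def PiE_iff)
      moreover have "f s \<notin> I \<inter> {..<fst s}" if "fst s \<in> I"
        using f s that by (cases s) (auto simp: down_arcs_def)
      ultimately show ?thesis by (auto simp: B_def)
    qed
    then show "f \<in> PiE ?S B" using f by (auto simp: choices_def PiE_iff)
  qed
  then have "card ?N \<le> card (PiE ?S B)"
    by (rule card_mono[rotated]) (auto intro!: finite_PiE simp: B_def)
  then have "real (card ?N) \<le> real (card (PiE ?S B))" by simp
  also have "\<dots> = (\<Prod>s\<in>?S. real (card (B s)))"
    by (subst card_PiE) auto
  also have "\<dots> \<le> (\<Prod>s\<in>?S. (real (fst s) + 1) * exp (- h (fst s)))"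
  proof (rule prod_mono, intro conjI)
    fix s :: "nat \<times> nat"
    let ?i = "fst s"
    show "real (card (B s)) \<le> (real ?i + 1) * exp (- h ?i)"
    proof (cases "?i \<in> I")
      case True
      have "card (I \<inter> {..<?i}) \<le> card {..<?i}" by (rule card_mono) auto
      moreover have "card (B s) = card {..?i} - card (I \<inter> {..<?i})"
        unfolding B_def using True by (simp, subst card_Diff_subset) auto
      ultimately have "real (card (B s)) = real ?i + 1 - real (card (I \<inter> {..<?i}))"
        by simp
      also have "\<dots> = (real ?i + 1) * (1 + - h ?i)"
        using True by (simp add: h_def field_simps)
      also have "\<dots> \<le> (real ?i + 1) * exp (- h ?i)"
        by (intro mult_left_mono exp_ge_add_one_self) auto
      finally show ?thesis .
    qed (simp add: B_def h_def)
  qed simp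
  also have "\<dots> = real (card (choices n d)) * exp (- (\<Sum>s\<in>?S. h (fst s)))"
    by (simp add: prod.distrib card_choices exp_sum sum_negf[symmetric])
  also have "(\<Sum>s\<in>?S. h (fst s)) = real d * (\<Sum>i<n. h i)"
    by (simp add: sum.cartesian_product[symmetric, of "\<lambda>i j. h i", simplified case_prod_unfold] sum_distrib_left)
  also have "(\<Sum>i<n. h i) = (\<Sum>i\<in>I. real (card (I \<inter> {..<i})) / (real i + 1))"
    by (rule sum.mono_neutral_cong_right) (use I in \<open>auto simp: h_def\<close>)
  finally show ?thesis .
qed

text \<open>\<open>m\<close> counts the vertices other than the top \<open>v\<close>, so the range
  \<open>2..g - 2\<close> stands for cycle lengths from 3 to \<open>g - 1\<close>.\<close>

definition short_cycle_tops :: "nat \<Rightarrow> nat \<Rightarrow> nat \<Rightarrow> (nat \<times> nat \<Rightarrow> nat) \<Rightarrow> nat set" where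
  "short_cycle_tops n g d f = {v. v < n \<and>
     (\<exists>m\<in>{2..g - 2}. \<exists>us\<in>vpaths v m. path_arcs (v # us @ [v]) \<subseteq> down_arcs d f)}"

text \<open>Union bound over the candidate cycles. The two edges at \<open>v\<close> give
  \<open>1 / (v + 1)\<^sup>2\<close>, and the weights of the paths below \<open>v\<close> sum to at
  most \<open>catalan m * v\<close>, so one factor \<open>1 / (v + 1)\<close> survives;
  \<open>catalan_power_sum\<close> adds up the lengths.\<close>

lemma card_short_cycle_tops:
  assumes v: "v < n" and g: "4 \<le> g" and d: "2 \<le> d"
  shows "real (card {f \<in> choices n d. v \<in> short_cycle_tops n g d f})
    \<le> real (card (choices n d)) * (4 / 3 * (catalan (g - 2) * real d ^ (g - 1)) / (real v + 1))"
proof -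
  let ?c = "real (card (choices n d))"
  define N where "N us = {f \<in> choices n d. path_arcs (v # us @ [v]) \<subseteq> down_arcs d f}" for us
  have finN: "finite (N us)" for us by (simp add: N_def)
  obtain k where k: "g = 4 + k" using g le_Suc_ex by blast
  have N: "real (card (N us)) \<le> ?c * (real d ^ Suc m * path_weight us / (real v + 1)\<^sup>2)"
    if us: "us \<in> vpaths v m" and m: "m \<in> {2..g - 2}" for us m
  proof -
    have lt: "fst a < n" if "a \<in> path_arcs (v # us @ [v])" for a
      using path_arcs_in_set[OF that] us v by (auto simp: vpaths_def)
    have "(\<Prod>a\<in>path_arcs (v # us @ [v]). real d / (real (fst a) + 1))
        = real d ^ Suc m * path_weight us / (real v + 1)\<^sup>2"
      by (rule prod_closed_path_arcs) (use us m in auto)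
    with card_choices_down_arcs[of "path_arcs (v # us @ [v])" n d] lt show ?thesis
      unfolding N_def by simp
  qed
  have "card {f \<in> choices n d. v \<in> short_cycle_tops n g d f}
      \<le> card (\<Union>m\<in>{2..g - 2}. \<Union>us\<in>vpaths v m. N us)"
    by (rule card_mono) (auto simp: short_cycle_tops_def N_def)
  also have "\<dots> \<le> (\<Sum>m=2..g - 2. card (\<Union>us\<in>vpaths v m. N us))"
    by (rule card_UN_le) simp
  also have "\<dots> \<le> (\<Sum>m=2..g - 2. \<Sum>us\<in>vpaths v m. card (N us))"
    by (intro sum_mono card_UN_le) simp
  finally have "real (card {f \<in> choices n d. v \<in> short_cycle_tops n g d f})
      \<le> (\<Sum>m=2..g - 2. \<Sum>us\<in>vpaths v m. real (card (N us)))"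
    unfolding of_nat_sum[symmetric] of_nat_le_iff .
  also have "\<dots> \<le> (\<Sum>m=2..g - 2. \<Sum>us\<in>vpaths v m.
      ?c * (real d ^ Suc m * path_weight us / (real v + 1)\<^sup>2))"
    by (intro sum_mono N)
  also have "\<dots> = (\<Sum>m=2..g - 2. ?c * (real d ^ Suc m / (real v + 1)\<^sup>2)
      * (\<Sum>us\<in>vpaths v m. path_weight us))"
    unfolding sum_distrib_left by (intro sum.cong refl) simp
  also have "\<dots> \<le> (\<Sum>m=2..g - 2. ?c * (real d ^ Suc m / (real v + 1)\<^sup>2) * (catalan m * (real v + 1)))"
  proof (intro sum_mono mult_left_mono)
    fix m assume m: "m \<in> {2..g - 2}"
    then have "(\<Sum>us\<in>vpaths v m. path_weight us) \<le> catalan m * real v"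
      using sum_path_weight[of v m] by auto
    also have "\<dots> \<le> catalan m * (real v + 1)"
      by (intro mult_left_mono catalan_nonneg) auto
    finally show "(\<Sum>us\<in>vpaths v m. path_weight us) \<le> catalan m * (real v + 1)" .
  qed auto
  also have "\<dots> = ?c * ((\<Sum>m=2..g - 2. catalan m * real d ^ Suc m) / (real v + 1))"
    unfolding sum_distrib_left sum_divide_distrib
    by (rule sum.cong) (auto simp: power2_eq_square)
  also have "\<dots> \<le> ?c * (4 / 3 * (catalan (g - 2) * real d ^ (g - 1)) / (real v + 1))"
    using catalan_power_sum[of "real d" k] d
    by (intro mult_left_mono divide_right_mono) (auto simp: k)
  finally show ?thesis .
qed

section \<open>Averaging over all choices\<close>

lemma sum_power_card_Pow:
  fixes q :: real
  assumes "finite A"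
  shows "(\<Sum>I\<in>Pow A. q ^ card I) = (1 + q) ^ card A"
  using prod_add[OF assms, of "\<lambda>_. q" "\<lambda>_. 1"] by (simp add: add.commute)

text \<open>
  One averaging argument for both requirements: the sum of the normalised deleted weight and
  of the normalised partition function of the independent sets has mean less than 1. Each
  independent set enters the partition function with the reciprocal of an upper bound on its
  probability of being independent, which replaces a union bound.
\<close>
lemma exists_good_choice:
  fixes w :: "nat \<Rightarrow> real"
  assumes g: "4 \<le> g" and d: "2 \<le> d" and t: "0 < t" and q: "0 < q"
    and w: "\<And>v. v < n \<Longrightarrow> 0 \<le> w v"
    and bound: "(\<Sum>v<n. w v * (4 / 3 * (catalan (g - 2) * real d ^ (g - 1)) / (real v + 1)))
      < 3 / 4 * t"
  obtains f where "f \<in> choices n d" "(\<Sum>v\<in>short_cycle_tops n g d f. w v) < t"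
    "\<And>I. I \<subseteq> {..<n} \<Longrightarrow> \<forall>a\<in>I. \<forall>b\<in>I. (a, b) \<notin> down_arcs d f \<Longrightarrow>
      real d * (\<Sum>i\<in>I. real (card (I \<inter> {..<i})) / (real i + 1))
        \<le> ln 4 + real n * q - real (card I) * ln q"
proof -
  let ?O = "choices n d"
  let ?P = "\<lambda>v. 4 / 3 * (catalan (g - 2) * real d ^ (g - 1)) / (real v + 1)"
  define ind where "ind f I \<longleftrightarrow> (\<forall>a\<in>I. \<forall>b\<in>I. (a, b) \<notin> down_arcs d f)" for f and I :: "nat set"
  define Phi where "Phi I = real d * (\<Sum>i\<in>I. real (card (I \<inter> {..<i})) / (real i + 1))" for I
  define X where "X f = (\<Sum>v<n. if v \<in> short_cycle_tops n g d f then w v else 0)" for f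
  define Y where "Y f = (\<Sum>I\<in>Pow {..<n}. if ind f I then q ^ card I * exp (Phi I) else 0)" for f
  \<comment> \<open>\<open>Y\<close> has mean at most \<open>(1 + q) ^ n \<le> exp (n * q)\<close>,
    so the 4 leaves \<open>Y / ?Z\<close> a share of 1/4 next to the 3/4 of
    \<open>X / t\<close>.\<close>
  let ?Z = "4 * exp (real n * q)"
  have X0: "0 \<le> X f" for f unfolding X_def by (intro sum_nonneg) (use w in auto)
  have Y0: "0 \<le> Y f" for f unfolding Y_def by (intro sum_nonneg) (use q in auto)
  have count: "(\<Sum>f\<in>?O. if Q f then c else 0) = real (card {f \<in> ?O. Q f}) * c"
    for Q and c :: real
    by (simp add: sum.If_cases Int_def)
  have "(\<Sum>f\<in>?O. X f) = (\<Sum>v<n. \<Sum>f\<in>?O. if v \<in> short_cycle_tops n g d f then w v else 0)"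
    unfolding X_def by (rule sum.swap)
  also have "\<dots> \<le> (\<Sum>v<n. (real (card ?O) * ?P v) * w v)"
    unfolding count by (intro sum_mono mult_right_mono card_short_cycle_tops g d w) auto
  also have "\<dots> = real (card ?O) * (\<Sum>v<n. w v * ?P v)"
    by (simp add: sum_distrib_left mult_ac)
  also have "\<dots> < real (card ?O) * (3 / 4 * t)"
    by (intro mult_strict_left_mono bound card_choices_pos)
  finally have SX: "(\<Sum>f\<in>?O. X f) < real (card ?O) * (3 / 4 * t)" .
  have "(\<Sum>f\<in>?O. Y f)
      = (\<Sum>I\<in>Pow {..<n}. \<Sum>f\<in>?O. if ind f I then q ^ card I * exp (Phi I) else 0)"
    unfolding Y_def by (rule sum.swap)
  also have "\<dots> \<le> (\<Sum>I\<in>Pow {..<n}. (real (card ?O) * exp (- Phi I)) * (q ^ card I * exp (Phi I)))"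
    unfolding count using card_choices_independent[where n = n and d = d] q
    by (intro sum_mono mult_right_mono) (auto simp: ind_def Phi_def)
  also have "\<dots> = real (card ?O) * (\<Sum>I\<in>Pow {..<n}. q ^ card I)"
    by (simp add: sum_distrib_left exp_minus field_simps)
  also have "(\<Sum>I\<in>Pow {..<n}. q ^ card I) = (1 + q) ^ n"
    by (simp add: sum_power_card_Pow)
  also have "real (card ?O) * (1 + q) ^ n \<le> real (card ?O) * exp (real n * q)"
    using q power_mono[OF exp_ge_add_one_self[of q], of n]
    by (intro mult_left_mono) (auto simp: exp_of_nat_mult)
  finally have SY: "(\<Sum>f\<in>?O. Y f) \<le> real (card ?O) * exp (real n * q)" .
  have "\<exists>f\<in>?O. X f / t + Y f / ?Z < 1"
  proof (rule ccontr)
    assume "\<not> ?thesis"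
    then have "(\<Sum>f\<in>?O. 1) \<le> (\<Sum>f\<in>?O. X f / t + Y f / ?Z)"
      by (intro sum_mono) auto
    also have "\<dots> = (\<Sum>f\<in>?O. X f) / t + (\<Sum>f\<in>?O. Y f) / ?Z"
      by (simp add: sum.distrib sum_divide_distrib)
    also have "\<dots> < real (card ?O) * (3 / 4 * t) / t + real (card ?O) * exp (real n * q) / ?Z"
      using SX SY t by (intro add_less_le_mono divide_strict_right_mono divide_right_mono) auto
    also have "\<dots> = real (card ?O)" using t by simp
    finally show False by simp
  qed
  then obtain f where f: "f \<in> ?O" "X f / t + Y f / ?Z < 1" by blast
  have "0 \<le> X f / t" "0 \<le> Y f / ?Z" using X0[of f] Y0[of f] t by auto
  with f have "X f / t < 1" "Y f / ?Z < 1" by linarith+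
  then have Xf: "X f < t" and Yf: "Y f < ?Z" using t by (auto simp: field_simps)
  have "(\<Sum>v\<in>short_cycle_tops n g d f. w v) = X f"
    unfolding X_def by (rule sum.mono_neutral_cong_left) (auto simp: short_cycle_tops_def)
  with Xf have 1: "(\<Sum>v\<in>short_cycle_tops n g d f. w v) < t" by simp
  have 2: "real d * (\<Sum>i\<in>I. real (card (I \<inter> {..<i})) / (real i + 1))
        \<le> ln 4 + real n * q - real (card I) * ln q"
    if I: "I \<subseteq> {..<n}" "\<forall>a\<in>I. \<forall>b\<in>I. (a, b) \<notin> down_arcs d f" for I
  proof -
    \<comment> \<open>One term of \<open>Y f\<close> is bounded by the whole nonnegative sum; the
      claim is the logarithm of this.\<close>
    have "q ^ card I * exp (Phi I) = (if ind f I then q ^ card I * exp (Phi I) else 0)"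
      using I by (simp add: ind_def)
    also have "\<dots> \<le> Y f"
      unfolding Y_def by (rule member_le_sum) (use I q in auto)
    finally have "ln (q ^ card I * exp (Phi I)) \<le> ln ?Z"
      using Yf q by (subst ln_le_cancel_iff) auto
    then show ?thesis
      using q by (simp add: ln_mult ln_realpow Phi_def)
  qed
  show ?thesis by (rule that[OF f(1) 1 2])
qed

section \<open>Harmonic sums\<close>

lemma harm_eq_sum: "(harm n :: real) = (\<Sum>v<n. 1 / (real v + 1))"
  by (simp add: harm_altdef inverse_eq_divide add.commute)

text \<open>Each \<open>1 / j\<close> occurs in exactly \<open>j - 1\<close> of the
  differences.\<close>

lemma sum_harm_diff: "(\<Sum>v<n. harm n - harm (Suc v) :: real) = real n - harm n"
proof (induction n)
  case (Suc n)
  have "(\<Sum>v<Suc n. harm (Suc n) - harm (Suc v) :: real)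
      = (\<Sum>v<n. harm n - harm (Suc v)) + real n * inverse (real (Suc n))"
    by (simp add: harm_Suc[of n] sum.distrib[symmetric] sum_subtractf algebra_simps)
  also have "\<dots> = real n - harm n + real n * inverse (real (Suc n))"
    by (simp only: Suc)
  also have "\<dots> = real (Suc n) - harm (Suc n)"
    by (simp add: harm_Suc field_simps)
  finally show ?case .
qed (simp add: harm_def)

text \<open>The left side is the sum of \<open>1 / (i * j)\<close> over
  \<open>1 \<le> i < j \<le> n\<close>, half of the expanded square without its diagonal.\<close>

lemma sum_harm_diff_div: "(\<Sum>v<n. (harm n - harm (Suc v)) / (real v + 1)) \<le> (harm n :: real)\<^sup>2 / 2"
proof (induction n)
  case (Suc n)
  let ?i = "inverse (real (Suc n))"
  have "(\<Sum>v<Suc n. (harm (Suc n) - harm (Suc v)) / (real v + 1))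
      = (\<Sum>v<n. (harm n - harm (Suc v)) / (real v + 1) + ?i * (1 / (real v + 1)))"
    by (simp, rule sum.cong) (simp_all add: harm_Suc[of n] add_divide_distrib diff_divide_distrib)
  also have "\<dots> = (\<Sum>v<n. (harm n - harm (Suc v)) / (real v + 1)) + ?i * harm n"
    by (simp add: sum.distrib harm_eq_sum sum_distrib_left)
  also have "\<dots> \<le> (harm n)\<^sup>2 / 2 + ?i * harm n" using Suc by simp
  also have "\<dots> \<le> (harm (Suc n))\<^sup>2 / 2"
    by (simp add: harm_Suc power2_sum)
  finally show ?case .
qed (simp add: harm_def)

text \<open>
  The first two terms on the right are the tangent of the quadratic form on the left at uniform
  density \<open>x\<close>; \<open>harm n\<close> pays for the diagonal, and the last term (0 for \<open>n = 0\<close>) makes the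
  induction work.
\<close>
lemma density_tangent:
  fixes x :: real
  assumes "finite I"
  shows "2 * (\<Sum>i\<in>I \<inter> {..<n}. real (card (I \<inter> {..<i})) / (real i + 1))
    \<ge> 2 * x * (\<Sum>v\<in>I \<inter> {..<n}. 1 + harm n - harm (Suc v)) - 2 * x\<^sup>2 * real n - harm n
      + (real (card (I \<inter> {..<n})) - x * real n)\<^sup>2 / real n"
proof (induction n)
  case (Suc n)
  define s where "s = real (card (I \<inter> {..<n}))"
  define b :: real where "b = (if n \<in> I then 1 else 0)"
  define L where "L = (\<lambda>n. \<Sum>i\<in>I \<inter> {..<n}. real (card (I \<inter> {..<i})) / (real i + 1))"
  define R :: "nat \<Rightarrow> real" where "R = (\<lambda>n. \<Sum>v\<in>I \<inter> {..<n}. 1 + harm n - harm (Suc v))"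
  have set: "I \<inter> {..<Suc n} = (if n \<in> I then insert n (I \<inter> {..<n}) else I \<inter> {..<n})"
    by (auto simp: less_Suc_eq)
  have s': "real (card (I \<inter> {..<Suc n})) = s + b"
    unfolding set s_def b_def using assms by auto
  have L': "L (Suc n) = L n + b * s / (real n + 1)"
    unfolding L_def set s_def b_def using assms by auto
  have "(\<Sum>v\<in>I \<inter> {..<n}. 1 + harm (Suc n) - harm (Suc v)) 
      = (\<Sum>v\<in>I \<inter> {..<n}. (1 + harm n - harm (Suc v)) + 1 / (real n + 1))"
    by (intro sum.cong refl) (simp add: harm_Suc[of n] inverse_eq_divide algebra_simps)
  also have "\<dots> = R n + s / (real n + 1)"
    unfolding R_def s_def sum.distrib by simp
  finally have "(\<Sum>v\<in>I \<inter> {..<n}. 1 + harm (Suc n) - harm (Suc v)) = R n + s / (real n + 1)" .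
  then have R': "R (Suc n) = R n + s / (real n + 1) + b"
    unfolding R_def set b_def using assms by auto
  \<comment> \<open>The increment from \<open>n\<close> to \<open>n + 1\<close>. Once the old square
    is given the denominator \<open>n + 1\<close>, the two sides differ by exactly
    \<open>(b\<^sup>2 - x\<^sup>2 - 1) / (n + 1)\<close>; the 1 stems from \<open>harm\<close> and
    pays for \<open>b\<^sup>2\<close>.\<close>
  have main: "2 * x * (s / (real n + 1) + b) - 2 * x\<^sup>2 - 1 / (real n + 1)
      + (s + b - x * (real n + 1))\<^sup>2 / (real n + 1) - (s - x * real n)\<^sup>2 / real n
    \<le> 2 * (b * s / (real n + 1))"
  proof -
    have b2: "b\<^sup>2 \<le> 1" by (simp add: b_def)
    have "(s - x * real n)\<^sup>2 / (real n + 1) \<le> (s - x * real n)\<^sup>2 / real n"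
    proof (cases "n = 0")
      case False
      then show ?thesis by (intro divide_left_mono) auto
    qed (simp add: s_def)
    moreover have "2 * x * (s / (real n + 1) + b) - 2 * x\<^sup>2 - 1 / (real n + 1)
        + (s + b - x * (real n + 1))\<^sup>2 / (real n + 1) - (s - x * real n)\<^sup>2 / (real n + 1)
        = 2 * (b * s / (real n + 1)) + (b\<^sup>2 - x\<^sup>2 - 1) / (real n + 1)"
    proof -
      define N where "N = real n + 1"
      have N: "real n + 1 = N" "N \<noteq> 0" by (auto simp: N_def)
      have "2 * x * (s + b * N) - 2 * x\<^sup>2 * N - 1 + (s + b - x * N)\<^sup>2 - (s - x * real n)\<^sup>2
        = 2 * (b * s) + (b\<^sup>2 - x\<^sup>2 - 1)"
        by (simp add: N_def power2_eq_square algebra_simps)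
      from arg_cong[OF this, of "\<lambda>z. z / N"] show ?thesis
        unfolding N(1) using N(2) by (simp add: add_divide_distrib diff_divide_distrib distrib_left)
    qed
    moreover have "(b\<^sup>2 - x\<^sup>2 - 1) / (real n + 1) \<le> 0"
      using b2 zero_le_power2[of x] by (intro divide_nonpos_pos) linarith+
    ultimately show ?thesis by linarith
  qed
  have IH: "2 * x * R n - 2 * x\<^sup>2 * real n - harm n + (s - x * real n)\<^sup>2 / real n \<le> 2 * L n"
    using Suc.IH unfolding L_def R_def s_def .
  then have "2 * x * R (Suc n) - 2 * x\<^sup>2 * real (Suc n) - harm (Suc n)
      + (s + b - x * real (Suc n))\<^sup>2 / real (Suc n) \<le> 2 * L (Suc n)"
  proof -
    have "2 * x * R (Suc n) = 2 * x * R n + 2 * x * (s / (real n + 1) + b)"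
      "2 * x\<^sup>2 * real (Suc n) = 2 * x\<^sup>2 * real n + 2 * x\<^sup>2"
      by (simp_all add: R' algebra_simps)
    moreover have "harm (Suc n) = harm n + 1 / (real n + 1)" "real (Suc n) = real n + 1"
      by (simp_all add: harm_Suc inverse_eq_divide add.commute)
    ultimately show ?thesis using IH main unfolding L' by (simp only: distrib_left)
  qed
  then show ?case unfolding L_def R_def s'[symmetric] .
qed (simp add: harm_def)

section \<open>The graph of a choice\<close>

definition pruned_graph :: "nat \<Rightarrow> nat \<Rightarrow> nat \<Rightarrow> (nat \<times> nat \<Rightarrow> nat) \<Rightarrow> nat pair_pre_digraph" where
  "pruned_graph n g d f = \<lparr>pverts = {..<n} - short_cycle_tops n g d f,
     parcs = {(a, b). a \<in> {..<n} - short_cycle_tops n g d f \<and>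
       b \<in> {..<n} - short_cycle_tops n g d f \<and>
       ((a, b) \<in> down_arcs d f \<or> (b, a) \<in> down_arcs d f)}\<rparr>"

lemma pverts_pruned_graph: "pverts (pruned_graph n g d f) = {..<n} - short_cycle_tops n g d f"
  by (simp add: pruned_graph_def)

lemma pair_graph_pruned_graph: "pair_graph (pruned_graph n g d f)"
proof
  show "finite (parcs (pruned_graph n g d f))"
    by (rule finite_subset[of _ "{..<n} \<times> {..<n}"]) (auto simp: pruned_graph_def)
  show "symmetric (with_proj (pruned_graph n g d f))"
    unfolding symmetric_def by (auto simp: pruned_graph_def intro!: symI)
qed (auto simp: pruned_graph_def down_arcs_def)

text \<open>In increasing order, the neighbours of a vertex among its predecessors all lie among its
  own \<open>d\<close> choices.\<close>

lemma degenerate_pruned_graph: "degenerate d (pruned_graph n g d f)"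
proof -
  let ?G = "pruned_graph n g d f"
  define vs where "vs = sorted_list_of_set (pverts ?G)"
  have fin: "finite (pverts ?G)" by (simp add: pverts_pruned_graph)
  have sorted: "sorted vs" "distinct vs" and set: "set vs = pverts ?G"
    using fin by (simp_all add: vs_def)
  have "card {u. vs ! i \<rightarrow>\<^bsub>with_proj ?G \<restriction> set (take (Suc i) vs)\<^esub> u} \<le> d" if i: "i < length vs" for i
  proof -
    let ?v = "vs ! i"
    have "{u. ?v \<rightarrow>\<^bsub>with_proj ?G \<restriction> set (take (Suc i) vs)\<^esub> u} \<subseteq> (\<lambda>j. f (?v, j)) ` {..<d}"
    proof
      fix u assume "u \<in> {u. ?v \<rightarrow>\<^bsub>with_proj ?G \<restriction> set (take (Suc i) vs)\<^esub> u}"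
      then have u: "u \<in> set (take (Suc i) vs)" and arc: "(?v, u) \<in> parcs ?G"
        by (auto simp: arcs_ends_def arc_to_ends_def induce_subgraph_def)
      from u i obtain k where k: "k \<le> i" "u = vs ! k"
        by (auto simp: in_set_conv_nth less_Suc_eq_le)
      have "u \<le> ?v"
        using k i sorted by (auto simp: sorted_iff_nth_mono)
      then show "u \<in> (\<lambda>j. f (?v, j)) ` {..<d}"
        using arc by (auto simp: pruned_graph_def down_arcs_def)
    qed
    then have "card {u. ?v \<rightarrow>\<^bsub>with_proj ?G \<restriction> set (take (Suc i) vs)\<^esub> u}
        \<le> card ((\<lambda>j. f (?v, j)) ` {..<d})"
      by (rule card_mono[rotated]) simp
    also have "\<dots> \<le> d" using card_image_le[of "{..<d}"] by simp
    finally show ?thesis .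
  qed
  then show ?thesis unfolding degenerate_def using sorted set
    by (intro exI[of _ vs]) auto
qed

section \<open>Walks and girth\<close>

lemma path_arcs_subset_down_arcs:
  "pcas u p w \<Longrightarrow> set p \<subseteq> parcs (pruned_graph n g d f) \<Longrightarrow>
    path_arcs (u # map snd p) \<subseteq> down_arcs d f"
proof (induction p arbitrary: u)
  case (Cons e p)
  then have "path_arcs (snd e # map snd p) \<subseteq> down_arcs d f" by auto
  moreover have "(max u (snd e), min u (snd e)) \<in> down_arcs d f"
    using Cons.prems by (cases e) (auto simp: pruned_graph_def down_arcs_def max_def min_def)
  ultimately show ?case by simp
qed simp

lemma pcas_append: "pcas u (p @ q) w \<longleftrightarrow> (\<exists>v. pcas u p v \<and> pcas v q w)"
  by (induction p arbitrary: u) auto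

lemma tl_pawalk_verts: "pcas u p w \<Longrightarrow> tl (pawalk_verts u p) = map snd p"
proof (induction p arbitrary: u)
  case (Cons e p)
  have "pawalk_verts v q = v # map snd q" if "pcas v q w" for v q
    using that by (induction q arbitrary: v) auto
  with Cons show ?case by auto
qed simp

text \<open>A cycle shorter than \<open>g\<close>, rotated to start and end at its largest vertex,
  shows that this vertex is in \<open>short_cycle_tops\<close> and was deleted.\<close>

lemma girth_pruned_graph: "girth_at_least g (pruned_graph n g d f)"
  unfolding girth_at_least_def
proof (intro allI impI)
  let ?G = "pruned_graph n g d f"
  interpret pair_graph ?G by (rule pair_graph_pruned_graph)
  fix p assume p: "pre_digraph.cycle (with_proj ?G) p \<and> 3 \<le> length p"
  then obtain u where u: "awalk u p u" "distinct (tl (pawalk_verts u p))"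
    unfolding cycle_def by auto
  then have cas: "pcas u p u" and arcs: "set p \<subseteq> parcs ?G" by (auto simp: awalk_def)
  with u have dist: "distinct (map snd p)" by (simp add: tl_pawalk_verts)
  define v where "v = Max (snd ` set p)"
  have ne: "snd ` set p \<noteq> {}" using p by auto
  have "v \<in> snd ` set p" and v_max: "\<And>x. x \<in> snd ` set p \<Longrightarrow> x \<le> v"
    using ne by (auto simp: v_def intro!: Max_in)
  then obtain e where e: "e \<in> set p" "snd e = v" by auto
  then obtain p1 p2 where p12: "p = p1 @ e # p2" by (metis in_set_conv_decomp)
  \<comment> \<open>The rotated cycle ends with the arc \<open>e\<close> into \<open>v\<close>;
    \<open>us\<close> lists the other vertices in cyclic order after \<open>v\<close>.\<close>
  define us where "us = map snd (p2 @ p1)"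
  have "pcas v (p2 @ p1 @ [e]) v"
  proof -
    obtain a where "pcas u p1 a" "pcas a (e # p2) u"
      using cas unfolding p12 pcas_append by blast
    then have "pcas v p2 u" "pcas u p1 (fst e)" "pcas (fst e) [e] v" using e by auto
    then show ?thesis unfolding pcas_append by blast
  qed
  then have "path_arcs (v # map snd (p2 @ p1 @ [e])) \<subseteq> down_arcs d f"
    by (rule path_arcs_subset_down_arcs) (use arcs p12 in auto)
  then have down: "path_arcs (v # us @ [v]) \<subseteq> down_arcs d f" by (simp add: us_def e)
  have "map snd p = map snd p1 @ v # map snd p2" by (simp add: p12 e)
  then have "v \<notin> set us" using dist unfolding us_def by (simp del: set_map)
  moreover have "set us \<subseteq> snd ` set p" by (auto simp: us_def p12)
  ultimately have "x < v" if "x \<in> set us" for x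
    using v_max[of x] that by (metis less_le subsetD)
  then have us: "us \<in> vpaths v (length p - 1)"
    using dist unfolding p12 us_def vpaths_def by auto
  have v: "v \<in> pverts ?G" using e arcs wellformed by (metis arc_snd_in_verts subsetD)
  show "g \<le> length p"
  proof (rule ccontr)
    assume "\<not> g \<le> length p"
    then have "length p - 1 \<in> {2..g - 2}" using p by auto
    moreover have "v < n" using v by (simp add: pverts_pruned_graph)
    ultimately have "v \<in> short_cycle_tops n g d f"
      using us down unfolding short_cycle_tops_def by blast
    with v show False by (simp add: pverts_pruned_graph)
  qed
qed

section \<open>Independent sets and linear programming duality\<close>

lemma independent_sets_pruned_graph:
  assumes "I \<in> independent_sets (pruned_graph n g d f)"
  shows "I \<subseteq> {..<n} - short_cycle_tops n g d f" "\<forall>a\<in>I. \<forall>b\<in>I. (a, b) \<notin> down_arcs d f"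
  using assms by (auto simp: independent_sets_def pruned_graph_def subset_iff)

text \<open>Weak duality: weigh the covering constraint of each \<open>v\<close> by
  \<open>w v\<close> and exchange the sums, so that \<open>x I\<close> gets the total weight of
  \<open>I\<close> as its coefficient.\<close>

lemma sum_weight_le_fractional_chromatic_number:
  fixes w :: "'a \<Rightarrow> real"
  assumes G: "pair_graph G" and w: "\<And>v. v \<in> pverts G \<Longrightarrow> 0 \<le> w v"
    and B: "\<And>I. I \<in> independent_sets G \<Longrightarrow> (\<Sum>v\<in>I. w v) \<le> B"
  shows "(\<Sum>v\<in>pverts G. w v) \<le> B * fractional_chromatic_number G"
proof -
  interpret pair_graph G by fact
  let ?S = "independent_sets G"
  have "?S \<subseteq> Pow (pverts G)" by (auto simp: independent_sets_def)
  then have finS: "finite ?S" using pair_finite_verts finite_subset by blast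
  obtain x where x: "fractional_colouring G x" "fractional_chromatic_number G = (\<Sum>I\<in>?S. x I)"
    using fractional_chromatic_number_attained[OF G] by blast
  have "(\<Sum>v\<in>pverts G. w v) \<le> (\<Sum>v\<in>pverts G. w v * (\<Sum>I\<in>{I \<in> ?S. v \<in> I}. x I))"
    using x w mult_left_mono[of 1 _ "w _"] by (intro sum_mono) (fastforce simp: fractional_colouring_def)
  also have "\<dots> = (\<Sum>v\<in>pverts G. \<Sum>I\<in>?S. if v \<in> I then w v * x I else 0)"
    unfolding sum.inter_filter[OF finS] sum_distrib_left by (intro sum.cong refl) simp
  also have "\<dots> = (\<Sum>I\<in>?S. \<Sum>v\<in>pverts G. if v \<in> I then w v * x I else 0)"
    by (rule sum.swap)
  also have "\<dots> = (\<Sum>I\<in>?S. (\<Sum>v\<in>I. w v) * x I)"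
  proof (rule sum.cong)
    fix I assume "I \<in> ?S"
    then have "pverts G \<inter> I = I" by (auto simp: independent_sets_def)
    then show "(\<Sum>v\<in>pverts G. if v \<in> I then w v * x I else 0) = (\<Sum>v\<in>I. w v) * x I"
      using pair_finite_verts by (simp add: sum.If_cases sum_distrib_right)
  qed simp
  also have "\<dots> \<le> (\<Sum>I\<in>?S. B * x I)"
    using x B by (intro sum_mono mult_right_mono) (auto simp: fractional_colouring_def)
  finally show ?thesis using x by (simp add: sum_distrib_left)
qed

section \<open>The lower bound\<close>

theorem theorem1p4:
  fixes g n d :: nat and \<delta> :: real
  assumes "g \<ge> 4"
    and "0 < \<delta>" and "\<delta> < 1"
    and "n \<ge> d" and "d \<ge> 2"
    and "1 / real (g - 1) * real ((2 * g - 4) choose (g - 2)) * real d ^ (g - 1)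
           \<le> \<delta> * (real n / (harm n)\<^sup>2)"
  shows "\<exists>G :: nat pair_pre_digraph.
           pair_graph G \<and> degenerate d G \<and> card (pverts G) \<le> n \<and> girth_at_least g G \<and>
           fractional_chromatic_number G \<ge> (1 - \<delta>) * (real d / (lambert_W (real d) + 1))"
proof -
  note g = assms(1) and \<delta> = assms(2,3) and nd = assms(4) and d = assms(5)
  define H where "H = (harm n :: real)"
  define T where "T = catalan (g - 2) * real d ^ (g - 1)"
  define W where "W = lambert_W (real d)"
  define q where "q = W / real d"
  define x where "x = (W + 1) / real d"
  \<comment> \<open>Multiplied by \<open>d\<close>, the tangent of \<open>density_tangent\<close>
    has the coefficient \<open>d * x = W + 1\<close>; the \<open>- W\<close> absorbs the term
    \<open>card I * ln q\<close>.\<close>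
  define w where "w v = (W + 1) * (1 + H - harm (Suc v)) - W" for v
  have W: "0 < W" "W * exp W = real d" unfolding W_def using lambert_W[of "real d"] d by auto
  have q0: "0 < q" using W d by (simp add: q_def)
  have "q = exp (- W)" unfolding q_def W(2)[symmetric] using W(1) by (simp add: exp_minus divide_inverse)
  then have ln_q: "ln q = - W" by simp
  have H_ge_1: "1 \<le> H" using harm_mono[of 1 n, where ?'a = real] nd d by (simp add: H_def harm_expand)
  have TH: "T * H\<^sup>2 \<le> \<delta> * real n"
  proof -
    have "2 * g - 4 = 2 * (g - 2)" "g - 2 + 1 = g - 1" using g by auto
    then have "T = 1 / real (g - 1) * real ((2 * g - 4) choose (g - 2)) * real d ^ (g - 1)"
      by (simp add: T_def catalan_def)
    also have "\<dots> \<le> \<delta> * (real n / H\<^sup>2)" unfolding H_def by (rule assms(6))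
    finally show ?thesis using H_ge_1 by (simp add: field_simps)
  qed
  have T_ge: "2 * real d ^ 3 \<le> T"
  proof -
    have "2 \<le> catalan (2 + k)" for k
    proof (induction k)
      case (Suc k)
      then show ?case using catalan_Suc_ge[of "2 + k"] by simp
    qed (simp add: catalan_2)
    from this[of "g - 4"] have "2 \<le> catalan (g - 2)" using g by (simp add: numeral_eq_Suc Suc_diff_Suc)
    moreover have "real d ^ 3 \<le> real d ^ (g - 1)" using g d by (intro power_increasing) auto
    ultimately show ?thesis unfolding T_def by (intro mult_mono) auto
  qed
  have d3: "8 \<le> real d ^ 3" using power_mono[of 2 "real d" 3] d by simp
  \<comment> \<open>The hypothesis itself makes \<open>n\<close> large, since
    \<open>T \<ge> 2 * 2 ^ 3\<close>; then \<open>H \<ge> harm 4 = 25/12\<close>.\<close>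
  have "16 \<le> T * H\<^sup>2"
    using mult_mono[of 16 T 1 "H\<^sup>2"] T_ge d3 H_ge_1 by (simp add: one_le_power)
  also have "\<dots> \<le> real n" using TH \<delta> mult_right_mono[of \<delta> 1 "real n"] by simp
  finally have n16: "16 \<le> n" by linarith
  have H2: "2 \<le> H"
    using harm_mono[of 4 n, where ?'a = real] n16 by (simp add: H_def harm_expand)
  have w1: "1 \<le> w v" if "v < n" for v
  proof -
    have "(harm (Suc v) :: real) \<le> H" unfolding H_def by (rule harm_mono) (use that in simp)
    then have "(W + 1) * 1 \<le> (W + 1) * (1 + H - harm (Suc v))"
      using W by (intro mult_left_mono) auto
    then show ?thesis by (simp add: w_def)
  qed
  \<comment> \<open>The weight that may be deleted: the total is
    \<open>(W + 2) * n - (W + 1) * H\<close>, and \<open>(1 - \<delta>) * (W + 2) * n\<close> of it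
    must remain.\<close>
  define t where "t = \<delta> * real n * (W + 2) - (W + 1) * H"
  have H_small: "16 * H \<le> \<delta> * real n"
  proof -
    have "16 * H \<le> T * H" using T_ge d3 H_ge_1 by (intro mult_right_mono) auto
    also have "\<dots> \<le> T * H\<^sup>2"
      using T_ge d3 H_ge_1 self_le_power[of H 2] by (intro mult_left_mono) auto
    finally show ?thesis using TH by linarith
  qed
  have t_ge: "15 / 16 * (\<delta> * real n * (W + 2)) \<le> t"
  proof -
    have "(W + 1) * (16 * H) \<le> (W + 2) * (\<delta> * real n)"
      using mult_mono[of "W + 1" "W + 2" "16 * H" "\<delta> * real n"] H_small W H_ge_1 by simp
    then show ?thesis by (simp add: t_def algebra_simps)
  qed
  have dn: "0 < \<delta> * real n * (W + 2)" using \<delta> n16 W by simp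
  have bound: "(\<Sum>v<n. w v * (4 / 3 * (catalan (g - 2) * real d ^ (g - 1)) / (real v + 1)))
      < 3 / 4 * t"
  proof -
    have "(\<Sum>v<n. w v * (4 / 3 * (catalan (g - 2) * real d ^ (g - 1)) / (real v + 1)))
        = (\<Sum>v<n. 4 / 3 * T * (1 / (real v + 1) + (W + 1) * ((harm n - harm (Suc v)) / (real v + 1))))"
    proof (intro sum.cong refl)
      fix v
      have "w v = 1 + (W + 1) * (harm n - harm (Suc v))"
        unfolding w_def H_def by (simp add: algebra_simps)
      then show "w v * (4 / 3 * (catalan (g - 2) * real d ^ (g - 1)) / (real v + 1))
          = 4 / 3 * T * (1 / (real v + 1) + (W + 1) * ((harm n - harm (Suc v)) / (real v + 1)))"
        unfolding T_def[symmetric] by (simp add: add_divide_distrib[symmetric])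
    qed
    also have "\<dots> = 4 / 3 * T * (H + (W + 1) * (\<Sum>v<n. (harm n - harm (Suc v)) / (real v + 1)))"
      unfolding sum_distrib_left[symmetric] sum.distrib harm_eq_sum[symmetric] H_def ..
    \<comment> \<open>\<open>H \<ge> 2\<close> gives \<open>H \<le> H\<^sup>2 / 2\<close>, so that
      both terms combine to the factor \<open>W + 2\<close>.\<close>
    also have "\<dots> \<le> 4 / 3 * T * (H\<^sup>2 / 2 + (W + 1) * (H\<^sup>2 / 2))"
      using sum_harm_diff_div[of n] T_ge d3 H2 W mult_right_mono[of 2 H H]
      by (intro mult_left_mono add_mono) (auto simp: H_def power2_eq_square)
    also have "\<dots> = 2 / 3 * (T * H\<^sup>2) * (W + 2)"
      by (simp add: algebra_simps)
    also have "\<dots> \<le> 2 / 3 * (\<delta> * real n) * (W + 2)"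
      using TH W by (intro mult_right_mono mult_left_mono) auto
    \<comment> \<open>By \<open>t_ge\<close> this comes down to
      \<open>2/3 < 3/4 * 15/16 = 45/64\<close>.\<close>
    also have "\<dots> < 3 / 4 * t" using t_ge dn by simp
    finally show ?thesis .
  qed
  have t0: "0 < t" using t_ge dn by linarith
  from w1 have w0: "0 \<le> w v" if "v < n" for v using that by fastforce
  obtain f where del: "(\<Sum>v\<in>short_cycle_tops n g d f. w v) < t"
    and ind: "\<And>I. I \<subseteq> {..<n} \<Longrightarrow> \<forall>a\<in>I. \<forall>b\<in>I. (a, b) \<notin> down_arcs d f \<Longrightarrow>
      real d * (\<Sum>i\<in>I. real (card (I \<inter> {..<i})) / (real i + 1))
        \<le> ln 4 + real n * q - real (card I) * ln q"
    by (rule exists_good_choice[OF g d t0 q0 w0 bound], assumption, rule that)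
  let ?G = "pruned_graph n g d f" and ?R = "short_cycle_tops n g d f"
  \<comment> \<open>The constants of \<open>density_tangent\<close>, multiplied by
    \<open>d / 2\<close>, and those of \<open>exists_good_choice\<close>.\<close>
  define B where "B = real d * x\<^sup>2 * real n + real n * q + ln 4 + real d * H / 2"
  have dx: "real d * x = W + 1" using d by (simp add: x_def)
  have "(\<Sum>v\<in>I. w v) \<le> B" if "I \<in> independent_sets ?G" for I
  proof -
    note I = independent_sets_pruned_graph[OF that]
    have In: "I \<subseteq> {..<n}" and fin: "finite I" using I finite_subset[of I "{..<n}"] by auto
    then have Int: "I \<inter> {..<n} = I" by auto
    define S where "S = (\<Sum>i\<in>I. real (card (I \<inter> {..<i})) / (real i + 1))"
    define Q where "Q = (\<Sum>v\<in>I. 1 + H - harm (Suc v))"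
    have "0 \<le> (real (card I) - x * real n)\<^sup>2 / real n" by simp
    then have "x * Q - x\<^sup>2 * real n - H / 2 \<le> S"
      using density_tangent[OF fin, where n = n and x = x] unfolding Int S_def Q_def H_def by linarith
    then have "real d * (x * Q - x\<^sup>2 * real n - H / 2) \<le> real d * S"
      by (intro mult_left_mono) auto
    then have "(real d * x) * Q - real d * x\<^sup>2 * real n - real d * H / 2 \<le> real d * S"
      by (simp add: algebra_simps)
    moreover have "real d * S \<le> ln 4 + real n * q + real (card I) * W"
      using ind[OF In I(2)] unfolding S_def ln_q by simp
    moreover have "(\<Sum>v\<in>I. w v) = (W + 1) * Q - real (card I) * W"
      unfolding w_def Q_def sum_distrib_left by (subst sum_subtractf) simp
    ultimately show ?thesis unfolding B_def dx by linarith
  qed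
  then have "(\<Sum>v\<in>pverts ?G. w v) \<le> B * fractional_chromatic_number ?G"
    by (rule sum_weight_le_fractional_chromatic_number[OF pair_graph_pruned_graph, rotated])
       (auto simp: pverts_pruned_graph w0)
  moreover have "(\<Sum>v\<in>pverts ?G. w v) = (W + 2) * real n - (W + 1) * H - (\<Sum>v\<in>?R. w v)"
  proof -
    have "(\<Sum>v<n. w v) = (W + 1) * (\<Sum>v<n. 1 + (harm n - harm (Suc v))) - W * real n"
      unfolding w_def H_def sum_distrib_left by (subst sum_subtractf) (simp add: add_diff_eq)
    also have "\<dots> = (W + 2) * real n - (W + 1) * H"
      unfolding sum.distrib sum_harm_diff H_def by (simp add: algebra_simps)
    finally have "(\<Sum>v<n. w v) = (W + 2) * real n - (W + 1) * H" .
    moreover have "?R \<subseteq> {..<n}" by (auto simp: short_cycle_tops_def)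
    ultimately show ?thesis by (simp add: pverts_pruned_graph sum_diff)
  qed
  ultimately have main: "(1 - \<delta>) * (real n * (W + 2)) \<le> B * fractional_chromatic_number ?G"
    using del by (simp add: t_def algebra_simps)
  have B0: "0 < B" unfolding B_def using q0 n16 H_ge_1
    by (intro add_pos_nonneg add_nonneg_pos) auto
  \<comment> \<open>The choice of \<open>x\<close> and \<open>q\<close> gives
    \<open>(W + 1)\<^sup>2 + W = (W + 2) * (W + 1) - 1\<close>; the spare \<open>n\<close> covers
    the error terms.\<close>
  have B_le: "B * real d \<le> real n * (W + 2) * (W + 1)"
  proof -
    have "real d * x\<^sup>2 * real n * real d = (W + 1)\<^sup>2 * real n"
      unfolding dx[symmetric] by (simp add: power2_eq_square)
    moreover have "real n * q * real d = real n * W" using d by (simp add: q_def)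
    ultimately have "B * real d = real n * ((W + 2) * (W + 1)) - real n + (ln 4 * real d + (real d)\<^sup>2 * H / 2)"
      unfolding B_def by (simp add: algebra_simps power2_eq_square)
    \<comment> \<open>Both terms are at most multiples of \<open>d\<^sup>2 * H\<close>, together at
      most \<open>2 * d ^ 3 * H\<^sup>2 \<le> T * H\<^sup>2\<close>, which the hypothesis
      bounds.\<close>
    moreover have "ln 4 * real d + (real d)\<^sup>2 * H / 2 \<le> real n"
    proof -
      have "ln (4 :: real) \<le> 3" using ln_le_minus_one[of "4 :: real"] by simp
      then have "ln 4 * real d \<le> 3 / 2 * (2 * real d)" using d by simp
      also have "\<dots> \<le> 3 / 2 * ((real d)\<^sup>2 * H)"
      proof (rule mult_left_mono)
        have "2 * real d * 1 \<le> (real d)\<^sup>2 * H"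
          unfolding power2_eq_square using d H_ge_1 by (intro mult_mono) auto
        then show "2 * real d \<le> (real d)\<^sup>2 * H" by simp
      qed simp
      finally have "ln 4 * real d + (real d)\<^sup>2 * H / 2 \<le> 2 * (real d)\<^sup>2 * H" by simp
      also have "\<dots> \<le> 2 * real d ^ 3 * H\<^sup>2"
        using d H_ge_1 self_le_power[of H 2] power_increasing[of 2 3 "real d"] by (intro mult_mono) auto
      also have "\<dots> \<le> T * H\<^sup>2" using T_ge by (intro mult_right_mono) auto
      also have "\<dots> \<le> real n" using TH \<delta> mult_right_mono[of \<delta> 1 "real n"] by simp
      finally show ?thesis .
    qed
    ultimately show ?thesis by simp
  qed
  have "B * ((1 - \<delta>) * (real d / (W + 1))) = (1 - \<delta>) * (B * real d / (W + 1))" by simp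
  also have "\<dots> \<le> (1 - \<delta>) * (real n * (W + 2))"
    using B_le W \<delta> by (intro mult_left_mono) (auto simp: divide_le_eq)
  also note main
  finally have "(1 - \<delta>) * (real d / (W + 1)) \<le> fractional_chromatic_number ?G"
    by (rule mult_left_le_imp_le) (rule B0)
  moreover have "card (pverts ?G) \<le> n"
    using card_mono[of "{..<n}" "pverts ?G"] by (auto simp: pverts_pruned_graph)
  ultimately show ?thesis
    using pair_graph_pruned_graph[of n g d f] degenerate_pruned_graph[of d n g f]
      girth_pruned_graph[of g n d f] unfolding W_def by blast
qed

end
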